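(* Let $(\mathcal X,\mathcal B,\angle)$ be a non-trivial angle space with four or more points. Then $(\mathcal X,\mathcal B,\angle)$ admits a Euclidean-compatible distance function $d$ if and only if every subspace of $\mathcal X$ consisting of four points admits a Euclidean-compatible distance function. This Euclidean-compatible distance function $d$ is unique up to multiplication by a (positive) constant.
   Context: Relation of betweenness. A relation of betweenness on a set $\mathcal X$ is a ternary relation $\mathcal B\subset\mathcal X^3$; if $(A,B,C)\in\mathcal B$ one says that $B$ is between $A$ and $C$. Points $A,B,C$ are called collinear if $(B,A,C)\in\mathcal B$ or $(A,B,C)\in\mathcal B$ or $(A,C,B)\in\mathcal B$. The relation is required to satisfy: (B1) if $(A,B,C)\in\mathcal B$ then $A,B,C$ are distinct; (B2) if $(A,B,C)\in\mathcal B$ then $(C,B,A)\in\mathcal B$; (B3) if $(A,B,C)\in\mathcal B$ then $(B,A,C)\notin\mathcal B$; (B4) if $(P_1,P_2,P_3),(Q_1,Q_2,Q_3)\in\mathcal B$ and these two triples of points have two points in common, then any set of three different points in $\{P_1,P_2,P_3\}\cup\{Q_1,Q_2,Q_3\}$ is collinear. Angle function. Let $\mathcal X^{3*}=\{(A,B,C)\in\mathcal X^3: B\neq A,\ B\neq C\}$. An angle function on $(\mathcal X,\mathcal B)$ is a map $\angle:\mathcal X^{3*}\to[0,\pi]$ such that: (i) $\angle(A,B,C)=\angle(C,B,A)$; (ii) $\angle(A,B,C)=0$ if $A=C$, or $(B,A,C)\in\mathcal B$, or $(B,C,A)\in\mathcal B$; $\angle(A,B,C)=\pi$ if $(A,B,C)\in\mathcal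 B$; and $\angle(A,B,C)>0$ in every other case; (iii) (Axiom of Collinearity) if $(B,C,D)\in\mathcal B$, then $\angle(A,B,C)=\angle(A,B,D)$ for all $A\neq B$. An angle space is a triple $(\mathcal X,\mathcal B,\angle)$ with $\mathcal X$ a set, $\mathcal B$ a relation of betweenness on $\mathcal X$ and $\angle$ an angle function. A subspace is a subset of $\mathcal X$ with the restrictions of $\mathcal B$ and $\angle$. An angle space is trivial if it has two points or every three (distinct) points in it are collinear; otherwise it is non-trivial. A distance function (metric) $d$ on $\mathcal X$ is Euclidean-compatible (with $\angle$) if for all $A,B,C\in\mathcal X$ with $A\neq B$ and $A\neq C$, $$d(B,C)^2=d(A,C)^2+d(A,B)^2-2\,d(A,C)\,d(A,B)\cos\angle(B,A,C).$$ *)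

theory Defs
  imports "HOL-Analysis.Analysis"
begin

text \<open>
  A space is given by a carrier \<open>X\<close>, a ternary relation \<open>Bt\<close> on \<open>X\<close> and a total function \<open>ang\<close>,
  of which only the values \<open>ang A B C\<close> with \<open>A, B, C \<in> X\<close>, \<open>B \<noteq> A\<close>, \<open>B \<noteq> C\<close> are meaningful.
\<close>

definition btw_collinear :: "('a \<times> 'a \<times> 'a) set \<Rightarrow> 'a \<Rightarrow> 'a \<Rightarrow> 'a \<Rightarrow> bool" where
  "btw_collinear Bt A B C \<longleftrightarrow> (B, A, C) \<in> Bt \<or> (A, B, C) \<in> Bt \<or> (A, C, B) \<in> Bt"

locale betweenness =
  fixes X :: "'a set" and Bt :: "('a \<times> 'a \<times> 'a) set"
  assumes btw_subset: "Bt \<subseteq> X \<times> X \<times> X"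
    and btw_distinct: "(A, B, C) \<in> Bt \<Longrightarrow> A \<noteq> B \<and> B \<noteq> C \<and> A \<noteq> C"
    and btw_sym: "(A, B, C) \<in> Bt \<Longrightarrow> (C, B, A) \<in> Bt"
    and btw_excl: "(A, B, C) \<in> Bt \<Longrightarrow> (B, A, C) \<notin> Bt"
    and btw_two_common:
      "\<lbrakk>(P1, P2, P3) \<in> Bt; (Q1, Q2, Q3) \<in> Bt;
        card ({P1, P2, P3} \<inter> {Q1, Q2, Q3}) \<ge> 2;
        {A, B, C} \<subseteq> {P1, P2, P3} \<union> {Q1, Q2, Q3};
        A \<noteq> B; B \<noteq> C; A \<noteq> C\<rbrakk> \<Longrightarrow> btw_collinear Bt A B C"

locale angle_space = betweenness X Bt
  for X :: "'a set" and Bt :: "('a \<times> 'a \<times> 'a) set" +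
  fixes ang :: "'a \<Rightarrow> 'a \<Rightarrow> 'a \<Rightarrow> real"
  assumes ang_range:
      "\<lbrakk>A \<in> X; B \<in> X; C \<in> X; B \<noteq> A; B \<noteq> C\<rbrakk> \<Longrightarrow> ang A B C \<in> {0..pi}"
    and ang_sym:
      "\<lbrakk>A \<in> X; B \<in> X; C \<in> X; B \<noteq> A; B \<noteq> C\<rbrakk> \<Longrightarrow> ang A B C = ang C B A"
    and ang_zero:
      "\<lbrakk>A \<in> X; B \<in> X; C \<in> X; B \<noteq> A; B \<noteq> C;
        A = C \<or> (B, A, C) \<in> Bt \<or> (B, C, A) \<in> Bt\<rbrakk> \<Longrightarrow> ang A B C = 0"
    and ang_pi: "(A, B, C) \<in> Bt \<Longrightarrow> ang A B C = pi"
    and ang_pos: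
      "\<lbrakk>A \<in> X; B \<in> X; C \<in> X; B \<noteq> A; B \<noteq> C;
        \<not> (A = C \<or> (B, A, C) \<in> Bt \<or> (B, C, A) \<in> Bt); (A, B, C) \<notin> Bt\<rbrakk> \<Longrightarrow> ang A B C > 0"
    and ang_collinearity:
      "\<lbrakk>(B, C, D) \<in> Bt; A \<in> X; A \<noteq> B\<rbrakk> \<Longrightarrow> ang A B C = ang A B D"

definition trivial_space :: "'a set \<Rightarrow> ('a \<times> 'a \<times> 'a) set \<Rightarrow> bool" where
  "trivial_space X Bt \<longleftrightarrow> card X = 2 \<or>
     (\<forall>A\<in>X. \<forall>B\<in>X. \<forall>C\<in>X. A \<noteq> B \<and> B \<noteq> C \<and> A \<noteq> C \<longrightarrow> btw_collinear Bt A B C)"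

text \<open>
  \<^const>\<open>Metric_space\<close> also requires nonnegativity and symmetry of \<open>d\<close> outside \<open>X\<close>. This only
  concerns the irrelevant values of \<open>d\<close>: every metric on \<open>X\<close> extends by \<open>0\<close> to such a function.
\<close>

definition euclidean_compatible ::
    "'a set \<Rightarrow> ('a \<Rightarrow> 'a \<Rightarrow> 'a \<Rightarrow> real) \<Rightarrow> ('a \<Rightarrow> 'a \<Rightarrow> real) \<Rightarrow> bool" where
  "euclidean_compatible X ang d \<longleftrightarrow> Metric_space X d \<and>
     (\<forall>A\<in>X. \<forall>B\<in>X. \<forall>C\<in>X. A \<noteq> B \<and> A \<noteq> C \<longrightarrow>
        (d B C)\<^sup>2 = (d A C)\<^sup>2 + (d A B)\<^sup>2 - 2 * d A C * d A B * cos (ang B A C))"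

text \<open>
  The subspace on \<open>S \<subseteq> X\<close> has relation \<open>Bt \<inter> (S \<times> S \<times> S)\<close> and the same function \<open>ang\<close>, now read on
  triples from \<open>S\<close>. Euclidean compatibility on \<open>S\<close> does not refer to the betweenness relation.
\<close>

lemma (in angle_space) angle_space_subspace:
  assumes "S \<subseteq> X"
  shows "angle_space S (Bt \<inter> (S \<times> S \<times> S)) ang"
proof -
  have mem: "A \<in> X" if "A \<in> S" for A
    using assms that by (rule subsetD)
  show ?thesis
  proof (unfold_locales, goal_cases)
    case 1
    show ?case by (rule Int_lower2)
  next
    case (2 A B C)
    show ?case by (rule btw_distinct[OF IntD1[OF 2]])
  next
    case (3 A B C)
    then show ?case using btw_sym by (simp add: mem_Times_iff)
  next
    case (4 A B C)
    show ?case using btw_excl[OF IntD1[OF 4]] by simp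
  next
    case (5 P1 P2 P3 Q1 Q2 Q3 A B C)
    have "btw_collinear Bt A B C"
      by (rule btw_two_common[OF IntD1[OF 5(1)] IntD1[OF 5(2)] 5(3-7)])
    moreover have "{P1, P2, P3} \<union> {Q1, Q2, Q3} \<subseteq> S"
      using 5(1,2) by simp
    then have "{A, B, C} \<subseteq> S"
      by (rule subset_trans[OF 5(4)])
    ultimately show ?case
      by (simp add: btw_collinear_def)
  next
    case (6 A B C)
    then show ?case by (intro ang_range mem)
  next
    case (7 A B C)
    then show ?case by (intro ang_sym mem)
  next
    case (8 A B C)
    from 8(6) have "A = C \<or> (B, A, C) \<in> Bt \<or> (B, C, A) \<in> Bt" by blast
    with 8(1-5) show ?case by (intro ang_zero mem)
  next
    case (9 A B C)
    show ?case by (rule ang_pi[OF IntD1[OF 9]])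
  next
    case (10 A B C)
    from 10(1-3,6,7) have "\<not> (A = C \<or> (B, A, C) \<in> Bt \<or> (B, C, A) \<in> Bt)" "(A, B, C) \<notin> Bt"
      by simp_all
    with 10(1-5) show ?case by (intro ang_pos mem)
  next
    case (11 B C D A)
    show ?case by (rule ang_collinearity[OF IntD1[OF 11(1)] mem[OF 11(2)] 11(3)])
  qed
qed

end

theory Submission
  imports Defs
begin

text \<open>
  In a triangle with a compatible metric the law of sines holds, so its angles determine the
  quotient of two sides (\<open>compatible_side_ratio\<close>), and by the cosine law the distances from one
  point determine all others (\<open>compatible_determined_from_point\<close>). Both facts together give
  uniqueness: fixing one distance \<open>AB\<close> fixes the distance from \<open>A\<close> to every point off the line
  \<open>AB\<close>, then, through such a point, to every point on that line, and then the metric.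

  For existence, let \<open>A\<close> be a point on three different lines, which exists by \<open>ex_three_lines\<close>.
  The law of sines prescribes the ratio \<open>AP : AQ\<close> for all \<open>P\<close> and \<open>Q\<close> that are not in line with
  \<open>A\<close>. On a four-point set \<open>APQR\<close> a compatible metric exists, so the prescribed ratios satisfy
  the cocycle identity \<open>(AP : AQ) (AQ : AR) = AP : AR\<close> whenever \<open>P\<close>, \<open>Q\<close>, \<open>R\<close> are on three
  different lines through \<open>A\<close>. Since there are at least three such lines, the cocycle comes from
  one function, the distance from \<open>A\<close> (\<open>radius\<close>, \<open>radius_ratio\<close>). The cosine law at \<open>A\<close> turns it
  into a candidate \<open>glued\<close> for the metric.

  To be a compatible metric is a condition on triples \<open>P\<close>, \<open>Q\<close>, \<open>R\<close>. If these are not all on one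
  line through \<open>A\<close>, the compatible metric of the four-point set \<open>APQR\<close> is, up to scale, the
  candidate (\<open>agrees_on_triangle\<close>). If they are, then the metric of \<open>PQRT\<close> is used, for a point
  \<open>T\<close> off that line (\<open>agrees_on_line\<close>).
\<close>

section \<open>Compatible metrics on subsets\<close>

lemma euclidean_compatible_subset:
  assumes "euclidean_compatible S ang d" "T \<subseteq> S"
  shows "euclidean_compatible T ang d"
  using assms Metric_space.subspace[of S d T]
  unfolding euclidean_compatible_def by blast

lemma euclidean_compatible_scale:
  assumes "euclidean_compatible S ang d" "0 < c"
  shows "euclidean_compatible S ang (\<lambda>P Q. c * d P Q)"
proof -
  interpret Metric_space S d
    using assms by (simp add: euclidean_compatible_def)
  have "Metric_space S (\<lambda>P Q. c * d P Q)"
  proof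
    fix P Q R assume "P \<in> S" "Q \<in> S" "R \<in> S"
    then show "c * d P R \<le> c * d P Q + c * d Q R"
      using triangle[of P Q R] assms(2) by (simp flip: distrib_left)
  qed (use assms(2) commute in auto)
  moreover have "(c * d Q R)\<^sup>2 =
      (c * d P R)\<^sup>2 + (c * d P Q)\<^sup>2 - 2 * (c * d P R) * (c * d P Q) * cos (ang Q P R)"
    if "P \<in> S" "Q \<in> S" "R \<in> S" "P \<noteq> Q" "P \<noteq> R" for P Q R
  proof -
    have "(d Q R)\<^sup>2 = (d P R)\<^sup>2 + (d P Q)\<^sup>2 - 2 * d P R * d P Q * cos (ang Q P R)"
      using assms(1) that unfolding euclidean_compatible_def by blast
    then have "c\<^sup>2 * (d Q R)\<^sup>2 =
        c\<^sup>2 * ((d P R)\<^sup>2 + (d P Q)\<^sup>2 - 2 * d P R * d P Q * cos (ang Q P R))"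
      by simp
    then show ?thesis
      by (simp add: power_mult_distrib algebra_simps power2_eq_square)
  qed
  ultimately show ?thesis
    by (simp add: euclidean_compatible_def)
qed

text \<open>
  Being Euclidean-compatible is a condition on triples of points, the triangle inequality
  included; so it may be tested with a different witness for every triple.
\<close>

lemma euclidean_compatible_if_locally:
  assumes nonneg: "\<And>P Q. 0 \<le> d P Q" and sym: "\<And>P Q. d P Q = d Q P"
    and loc: "\<And>P Q R. \<lbrakk>P \<in> X; Q \<in> X; R \<in> X\<rbrakk> \<Longrightarrow>
      \<exists>d'. euclidean_compatible {P, Q, R} ang d' \<and>
           (\<forall>U\<in>{P, Q, R}. \<forall>V\<in>{P, Q, R}. d' U V = d U V)"
  shows "euclidean_compatible X ang d"
proof -
  have zero: "d P Q = 0 \<longleftrightarrow> P = Q" if PQ: "P \<in> X" "Q \<in> X" for P Q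
  proof -
    obtain d' where d': "euclidean_compatible {P, Q, Q} ang d'"
      "\<forall>U\<in>{P, Q, Q}. \<forall>V\<in>{P, Q, Q}. d' U V = d U V"
      using loc[of P Q Q] PQ by blast
    then interpret Metric_space "{P, Q, Q}" d'
      by (simp add: euclidean_compatible_def)
    show ?thesis using d'(2) zero[of P Q] by simp
  qed
  have tri: "d P R \<le> d P Q + d Q R" if PQR: "P \<in> X" "Q \<in> X" "R \<in> X" for P Q R
  proof -
    obtain d' where d': "euclidean_compatible {P, Q, R} ang d'"
      "\<forall>U\<in>{P, Q, R}. \<forall>V\<in>{P, Q, R}. d' U V = d U V"
      using loc[of P Q R] PQR by blast
    then interpret Metric_space "{P, Q, R}" d'
      by (simp add: euclidean_compatible_def)
    show ?thesis using d'(2) triangle[of P Q R] by simp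
  qed
  have cosine: "(d Q R)\<^sup>2 = (d P R)\<^sup>2 + (d P Q)\<^sup>2 - 2 * d P R * d P Q * cos (ang Q P R)"
    if PQR: "P \<in> X" "Q \<in> X" "R \<in> X" "P \<noteq> Q" "P \<noteq> R" for P Q R
  proof -
    obtain d' where d': "euclidean_compatible {P, Q, R} ang d'"
      "\<forall>U\<in>{P, Q, R}. \<forall>V\<in>{P, Q, R}. d' U V = d U V"
      using loc[of P Q R] PQR by blast
    have "(d' Q R)\<^sup>2 = (d' P R)\<^sup>2 + (d' P Q)\<^sup>2 - 2 * d' P R * d' P Q * cos (ang Q P R)"
      using d'(1) PQR(4,5) by (simp add: euclidean_compatible_def)
    then show ?thesis using d'(2) by simp
  qed
  show ?thesis
    unfolding euclidean_compatible_def
  proof (intro conjI ballI impI)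
    show "Metric_space X d"
      by unfold_locales (use nonneg sym zero tri in auto)
  qed (use cosine in auto)
qed

context
  fixes S :: "'a set" and ang d
  assumes comp: "euclidean_compatible S ang d"
begin

interpretation Metric_space S d
  using comp by (simp add: euclidean_compatible_def)

lemma compatible_nonneg: "0 \<le> d P Q"
  by simp

lemma compatible_commute: "d P Q = d Q P"
  by (rule commute)

lemma compatible_pos: "\<lbrakk>P \<in> S; Q \<in> S; P \<noteq> Q\<rbrakk> \<Longrightarrow> 0 < d P Q"
  using nonneg[of P Q] zero[of P Q] by linarith

lemma compatible_self: "P \<in> S \<Longrightarrow> d P P = 0"
  by simp

lemma compatible_cosine:
  "\<lbrakk>P \<in> S; Q \<in> S; R \<in> S; P \<noteq> Q; P \<noteq> R\<rbrakk> \<Longrightarrow>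
    (d Q R)\<^sup>2 = (d P R)\<^sup>2 + (d P Q)\<^sup>2 - 2 * d P R * d P Q * cos (ang Q P R)"
  using comp by (simp add: euclidean_compatible_def)

end

text \<open>
  By the cosine law at \<open>P\<close>, the distances from \<open>P\<close> carry the whole metric.
\<close>

lemma compatible_determined_from_point:
  assumes d: "euclidean_compatible S ang d" and d': "euclidean_compatible S' ang d'"
    and S: "P \<in> S" "Q \<in> S" "R \<in> S" and S': "P \<in> S'" "Q \<in> S'" "R \<in> S'"
    and PQ: "d P Q = d' P Q" and PR: "d P R = d' P R"
  shows "d Q R = d' Q R"
proof (cases "P = Q \<or> P = R")
  case True
  then show ?thesis
    using PQ PR compatible_commute[OF d, of Q R] compatible_commute[OF d', of Q R] by auto
next
  case False
  then have "(d Q R)\<^sup>2 = (d' Q R)\<^sup>2"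
    using compatible_cosine[OF d S] compatible_cosine[OF d' S'] PQ PR by simp
  then show ?thesis
    using compatible_nonneg[OF d] compatible_nonneg[OF d'] by (simp add: power2_eq_iff_nonneg)
qed

section \<open>Triangles\<close>

context angle_space
begin

definition noncollinear :: "'a \<Rightarrow> 'a \<Rightarrow> 'a \<Rightarrow> bool" where
  "noncollinear P Q R \<longleftrightarrow> P \<in> X \<and> Q \<in> X \<and> R \<in> X \<and> P \<noteq> Q \<and> Q \<noteq> R \<and> P \<noteq> R \<and>
     \<not> btw_collinear Bt P Q R"

lemma btw_sym_iff: "(P, Q, R) \<in> Bt \<longleftrightarrow> (R, Q, P) \<in> Bt"
  using btw_sym[of P Q R] btw_sym[of R Q P] by blast

lemma noncollinear_rotate: "noncollinear P Q R \<Longrightarrow> noncollinear Q R P"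
  unfolding noncollinear_def btw_collinear_def
  using btw_sym_iff[of P Q R] btw_sym_iff[of Q P R] btw_sym_iff[of P R Q] by auto

lemma noncollinear_swap: "noncollinear P Q R \<Longrightarrow> noncollinear P R Q"
  unfolding noncollinear_def btw_collinear_def
  using btw_sym_iff[of P Q R] btw_sym_iff[of Q P R] btw_sym_iff[of P R Q] by auto

text \<open>
  Two lines through \<open>P\<close> share no other point: this is what the fourth betweenness axiom says
  about two collinear triples with the common points \<open>P\<close> and \<open>T\<close>.
\<close>

lemma noncollinear_cases:
  assumes PQR: "noncollinear P Q R" and T: "T \<in> X" "T \<noteq> P"
  shows "noncollinear P T Q \<or> noncollinear P T R"
proof (rule ccontr)
  assume contr: "\<not> ?thesis"
  have span: "\<exists>U' V' W'. (U', V', W') \<in> Bt \<and> {U', V', W'} = {U, V, W}"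
    if "btw_collinear Bt U V W" for U V W
    using that unfolding btw_collinear_def
    by (elim disjE) (intro exI conjI, assumption, blast)+
  then have TQR: "T \<noteq> Q" "T \<noteq> R"
    using contr PQR noncollinear_swap[OF PQR] by blast+
  then have "btw_collinear Bt P T Q" "btw_collinear Bt P T R"
    using contr PQR T unfolding noncollinear_def by blast+
  then obtain P1 P2 P3 Q1 Q2 Q3 where
    col: "(P1, P2, P3) \<in> Bt" "{P1, P2, P3} = {P, T, Q}"
         "(Q1, Q2, Q3) \<in> Bt" "{Q1, Q2, Q3} = {P, T, R}"
    using span by metis
  have "{P1, P2, P3} \<inter> {Q1, Q2, Q3} = {P, T}"
    using col PQR T TQR by (auto simp: noncollinear_def)
  then have "card ({P1, P2, P3} \<inter> {Q1, Q2, Q3}) \<ge> 2"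
    using T by simp
  moreover have "{P, Q, R} \<subseteq> {P1, P2, P3} \<union> {Q1, Q2, Q3}"
    using col by auto
  ultimately have "btw_collinear Bt P Q R"
    using btw_two_common[OF col(1,3)] PQR by (auto simp: noncollinear_def)
  then show False
    using PQR by (simp add: noncollinear_def)
qed

lemma noncollinear_angle_pos: "noncollinear P Q R \<Longrightarrow> 0 < ang P Q R"
  using ang_pos[of P Q R] btw_sym_iff[of P R Q]
  unfolding noncollinear_def btw_collinear_def by auto

text \<open>
  The angle axioms alone allow the value \<open>\<pi>\<close> at a vertex of a non-degenerate triangle. A compatible
  metric excludes it, because the triangle would then have an angle \<open>0\<close> at another vertex.
\<close>

lemma sin_angle_pos:
  assumes d: "euclidean_compatible S ang d" and S: "P \<in> S" "Q \<in> S" "R \<in> S"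
    and PQR: "noncollinear P Q R"
  shows "0 < sin (ang P Q R)"
proof -
  have ne: "P \<noteq> Q" "Q \<noteq> R" "P \<noteq> R" and X: "P \<in> X" "Q \<in> X" "R \<in> X"
    using PQR by (auto simp: noncollinear_def)
  have range: "0 < ang P Q R" "ang P Q R \<le> pi"
    using noncollinear_angle_pos[OF PQR] ang_range[of P Q R] X ne by auto
  have "ang P Q R \<noteq> pi"
  proof
    assume straight: "ang P Q R = pi"
    have "(d P R)\<^sup>2 = (d Q R + d Q P)\<^sup>2"
      using compatible_cosine[OF d S(2,1,3)] ne straight by (simp add: power2_sum)
    then have PR: "d P R = d Q R + d Q P"
      using compatible_nonneg[OF d] by (simp add: power2_eq_iff_nonneg)
    have QP: "0 < d Q P" and QR: "0 < d Q R"
      using compatible_pos[OF d] S ne by auto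
    have "(d Q R)\<^sup>2 = (d P R)\<^sup>2 + (d P Q)\<^sup>2 - 2 * d P R * d P Q * cos (ang Q P R)"
      using compatible_cosine[OF d S] ne by simp
    moreover have "d P Q = d Q P"
      by (rule compatible_commute[OF d])
    ultimately have "2 * d P R * d Q P * (1 - cos (ang Q P R)) = 0"
      using PR by (simp add: power2_eq_square algebra_simps)
    then have "cos (ang Q P R) = 1"
      using PR QP QR by simp
    moreover have "0 < ang Q P R" "ang Q P R \<le> pi"
      using noncollinear_angle_pos[OF noncollinear_swap[OF noncollinear_rotate[OF PQR]]]
        ang_range[of Q P R] X ne by auto
    ultimately show False
      using cos_monotone_0_pi[of 0 "ang Q P R"] by simp
  qed
  then show ?thesis
    using range by (intro sin_gt_zero) auto
qed

lemma law_of_sines: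
  assumes d: "euclidean_compatible S ang d" and S: "P \<in> S" "Q \<in> S" "R \<in> S"
    and PQR: "noncollinear P Q R"
  shows "d P Q * sin (ang P Q R) = d P R * sin (ang P R Q)"
proof -
  have ne: "P \<noteq> Q" "Q \<noteq> R" "P \<noteq> R"
    using PQR by (auto simp: noncollinear_def)
  define a b c where "a = d Q R" and "b = d P R" and "c = d P Q"
  have cosQ: "b\<^sup>2 = a\<^sup>2 + c\<^sup>2 - 2 * a * c * cos (ang P Q R)"
    using compatible_cosine[OF d S(2,1,3)] ne
    by (simp add: a_def b_def c_def compatible_commute[OF d, of Q P])
  have cosR: "c\<^sup>2 = a\<^sup>2 + b\<^sup>2 - 2 * a * b * cos (ang P R Q)"
    using compatible_cosine[OF d S(3,1,2)] ne
    by (simp add: a_def b_def c_def compatible_commute[OF d, of R])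
  have a: "0 < a"
    using compatible_pos[OF d] S ne by (simp add: a_def)
  \<comment> \<open>The side \<open>QR\<close> is the sum of the projections of the two other sides.\<close>
  have "a * (c * cos (ang P Q R) + b * cos (ang P R Q)) = a * a"
    using cosQ cosR by (simp add: power2_eq_square algebra_simps)
  then have proj: "c * cos (ang P Q R) + b * cos (ang P R Q) = a"
    using a by simp
  have "c\<^sup>2 - b\<^sup>2 = a * (c * cos (ang P Q R) - b * cos (ang P R Q))"
    using cosQ cosR by (simp add: power2_eq_square algebra_simps)
  also have "\<dots> = (c * cos (ang P Q R))\<^sup>2 - (b * cos (ang P R Q))\<^sup>2"
    by (simp add: proj[symmetric] power2_eq_square algebra_simps)
  finally have "(c * sin (ang P Q R))\<^sup>2 = (b * sin (ang P R Q))\<^sup>2"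
    by (simp add: power_mult_distrib sin_squared_eq algebra_simps)
  moreover have "0 \<le> c * sin (ang P Q R)" "0 \<le> b * sin (ang P R Q)"
    using sin_angle_pos[OF d S PQR] sin_angle_pos[OF d S(1,3,2) noncollinear_swap[OF PQR]]
      compatible_nonneg[OF d] by (auto simp: b_def c_def)
  ultimately show ?thesis
    by (simp add: power2_eq_iff_nonneg b_def c_def)
qed

text \<open>
  The quotient \<open>PQ : PR\<close> that the law of sines reads off from the angles of the triangle \<open>PQR\<close>.
\<close>

definition side_ratio :: "'a \<Rightarrow> 'a \<Rightarrow> 'a \<Rightarrow> real" where
  "side_ratio P Q R = sin (ang P R Q) / sin (ang P Q R)"

lemma compatible_side_ratio:
  assumes "euclidean_compatible S ang d" "P \<in> S" "Q \<in> S" "R \<in> S" "noncollinear P Q R"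
  shows "d P Q = side_ratio P Q R * d P R"
  using law_of_sines[OF assms] sin_angle_pos[OF assms] by (simp add: side_ratio_def field_simps)

text \<open>
  Since the ratio of two sides of a triangle is forced, the quotient of two compatible metrics is
  the same on \<open>PQ\<close> and on \<open>PT\<close> whenever \<open>T\<close> is off the line \<open>PQ\<close>; all points are reached in at
  most two such steps.
\<close>

lemma compatible_unique_up_to_scale:
  assumes PQR: "noncollinear P Q R"
    and d: "euclidean_compatible X ang d" and d': "euclidean_compatible X ang d'"
  shows "\<exists>c>0. \<forall>U\<in>X. \<forall>V\<in>X. d' U V = c * d U V"
proof -
  have ne: "P \<noteq> Q" "P \<noteq> R" and X: "P \<in> X" "Q \<in> X" "R \<in> X"
    using PQR by (auto simp: noncollinear_def)
  define c where "c = d' P Q / d P Q"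
  have c: "0 < c"
    using compatible_pos[OF d, of P Q] compatible_pos[OF d', of P Q] ne X by (simp add: c_def)
  have Q: "d' P Q = c * d P Q"
    using compatible_pos[OF d, of P Q] ne X by (simp add: c_def)
  have step: "d' P T = c * d P T" if "noncollinear P T U" "d' P U = c * d P U" for T U
    using compatible_side_ratio[OF d _ _ _ that(1)] compatible_side_ratio[OF d' _ _ _ that(1)] that
    by (simp add: noncollinear_def)
  have star: "d' P T = c * d P T" if T: "T \<in> X" for T
  proof (cases "T = P")
    case True
    then show ?thesis
      using compatible_self[OF d] compatible_self[OF d'] X by simp
  next
    case False
    show ?thesis
      using noncollinear_cases[OF PQR T False] step Q step[OF noncollinear_swap[OF PQR] Q] by blast
  qed
  have "d' U V = c * d U V" if "U \<in> X" "V \<in> X" for U V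
    using compatible_determined_from_point[OF d' euclidean_compatible_scale[OF d c], of P U V]
      X that star by simp
  then show ?thesis
    using c by blast
qed

text \<open>
  If \<open>D\<close> is off the lines \<open>AB\<close> and \<open>AC\<close>, then \<open>A\<close> is on three different lines; if \<open>D\<close> is on
  \<open>AB\<close>, then \<open>C\<close> is, and if it is on \<open>AC\<close>, then \<open>B\<close> is.
\<close>

lemma ex_three_lines:
  assumes ABC: "noncollinear A B C" and D: "D \<in> X" "D \<notin> {A, B, C}"
  shows "\<exists>P Q R T. noncollinear P Q R \<and> noncollinear P Q T \<and> noncollinear P R T"
proof -
  have BCA: "noncollinear B C A" and CAB: "noncollinear C A B"
    using ABC noncollinear_rotate by blast+
  have A: "noncollinear A B D \<or> noncollinear A C D"
    using noncollinear_cases[OF ABC D(1)] D(2) noncollinear_swap by blast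
  have B: "noncollinear B C D \<or> noncollinear B A D"
    using noncollinear_cases[OF BCA D(1)] D(2) noncollinear_swap by blast
  have C: "noncollinear C A D \<or> noncollinear C B D"
    using noncollinear_cases[OF CAB D(1)] D(2) noncollinear_swap by blast
  have swap: "noncollinear B A D \<longleftrightarrow> noncollinear A B D"
    "noncollinear C A D \<longleftrightarrow> noncollinear A C D" "noncollinear C B D \<longleftrightarrow> noncollinear B C D"
    by (meson noncollinear_rotate noncollinear_swap)+
  consider "noncollinear A B D" "noncollinear A C D" | "noncollinear B C D" "noncollinear B A D"
    | "noncollinear C A D" "noncollinear C B D"
    using A B C swap by blast
  then show ?thesis
    using ABC BCA CAB by cases blast+
qed

end

section \<open>Gluing the metrics of the four-point subspaces\<close>

locale four_point_compatible = angle_space +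
  fixes A B C D
  assumes four_points:
      "\<lbrakk>P \<in> X; Q \<in> X; R \<in> X; T \<in> X\<rbrakk> \<Longrightarrow> \<exists>d. euclidean_compatible {P, Q, R, T} ang d"
    and three_lines: "noncollinear A B C" "noncollinear A B D" "noncollinear A C D"
begin

lemma base_mem: "A \<in> X"
  using three_lines by (simp add: noncollinear_def)

lemma side_ratio_pos:
  assumes "noncollinear P Q R"
  shows "0 < side_ratio P Q R"
proof -
  have X: "P \<in> X" "Q \<in> X" "R \<in> X"
    using assms by (auto simp: noncollinear_def)
  then obtain d where "euclidean_compatible {P, Q, R, R} ang d"
    using four_points by blast
  then show ?thesis
    using sin_angle_pos[of _ d P Q R] sin_angle_pos[of _ d P R Q] assms noncollinear_swap[OF assms]
    by (simp add: side_ratio_def)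
qed

lemma side_ratio_inverse:
  "noncollinear P Q R \<Longrightarrow> side_ratio P Q R * side_ratio P R Q = 1"
  using side_ratio_pos[of P Q R] by (auto simp: side_ratio_def)

lemma side_ratio_cocycle:
  assumes "noncollinear P Q R" "noncollinear P R T" "noncollinear P Q T"
  shows "side_ratio P Q T = side_ratio P Q R * side_ratio P R T"
proof -
  have X: "P \<in> X" "Q \<in> X" "R \<in> X" "T \<in> X" "P \<noteq> T"
    using assms by (auto simp: noncollinear_def)
  then obtain d where d: "euclidean_compatible {P, Q, R, T} ang d"
    using four_points by blast
  have "side_ratio P Q T * d P T = side_ratio P Q R * side_ratio P R T * d P T"
    using assms[THEN compatible_side_ratio[OF d, rotated 3]] by simp
  then show ?thesis
    using compatible_pos[OF d, of P T] X by simp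
qed

text \<open>
  The distance from \<open>A\<close> in the scale with \<open>AB\<close> of length \<open>1\<close>. The points of the line \<open>AB\<close> form no
  triangle with \<open>A\<close> and \<open>B\<close>, so they are measured through \<open>AC\<close>.
\<close>

definition radius :: "'a \<Rightarrow> real" where
  "radius P = (if P = A then 0 else if noncollinear A P B then side_ratio A P B
     else side_ratio A P C * side_ratio A C B)"

lemma radius_pos:
  assumes "P \<in> X" "P \<noteq> A"
  shows "0 < radius P"
  using noncollinear_cases[OF three_lines(1) assms] assms side_ratio_pos
    noncollinear_swap[OF three_lines(1)]
  by (auto simp: radius_def)

lemma radius_base: "radius A = 0"
  by (simp add: radius_def)

lemma radius_nonneg: "P \<in> X \<Longrightarrow> 0 \<le> radius P"
  using radius_pos[of P] radius_base by (cases "P = A") auto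

text \<open>
  The critical case is \<open>P\<close> on the line \<open>AB\<close> and \<open>Q\<close> on the line \<open>AC\<close>. Then \<open>P\<close>, \<open>Q\<close>, \<open>B\<close>, \<open>C\<close>
  are on only two lines through \<open>A\<close>, whereas each use of the cocycle identity needs three: every
  ratio is first expressed through the point \<open>D\<close> of the third line.
\<close>

lemma radius_ratio_aux:
  assumes PQ: "noncollinear A P Q" and P: "\<not> noncollinear A P B" and Q: "noncollinear A Q B"
  shows "radius P = side_ratio A P Q * radius Q"
proof -
  note swap = noncollinear_swap
  have X: "P \<in> X" "Q \<in> X" "P \<noteq> A" "Q \<noteq> A"
    using PQ by (auto simp: noncollinear_def)
  have PC: "noncollinear A P C"
    using noncollinear_cases[OF three_lines(1) X(1,3)] P by blast
  have PD: "noncollinear A P D"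
    using noncollinear_cases[OF three_lines(2) X(1,3)] P by blast
  have radP: "radius P = side_ratio A P C * side_ratio A C B"
    and radQ: "radius Q = side_ratio A Q B"
    using X P Q by (auto simp: radius_def)
  show ?thesis
  proof (cases "noncollinear A Q C")
    case True
    have "side_ratio A P C = side_ratio A P Q * side_ratio A Q C"
      by (rule side_ratio_cocycle[OF PQ True PC])
    moreover have "side_ratio A Q B = side_ratio A Q C * side_ratio A C B"
      by (rule side_ratio_cocycle[OF True swap[OF three_lines(1)] Q])
    ultimately show ?thesis
      using radP radQ by simp
  next
    case False
    then have QD: "noncollinear A Q D"
      using noncollinear_cases[OF three_lines(3) X(2,4)] by blast
    have "side_ratio A P C = side_ratio A P D * side_ratio A D C"
      by (rule side_ratio_cocycle[OF PD swap[OF three_lines(3)] PC])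
    moreover have "side_ratio A D B = side_ratio A D C * side_ratio A C B"
      by (rule side_ratio_cocycle[OF swap[OF three_lines(3)] swap[OF three_lines(1)]
            swap[OF three_lines(2)]])
    moreover have "side_ratio A P D = side_ratio A P Q * side_ratio A Q D"
      by (rule side_ratio_cocycle[OF PQ QD PD])
    moreover have "side_ratio A Q B = side_ratio A Q D * side_ratio A D B"
      by (rule side_ratio_cocycle[OF QD swap[OF three_lines(2)] Q])
    ultimately show ?thesis
      using radP radQ by simp
  qed
qed

lemma radius_ratio:
  assumes PQ: "noncollinear A P Q"
  shows "radius P = side_ratio A P Q * radius Q"
proof -
  have QP: "noncollinear A Q P"
    by (rule noncollinear_swap[OF PQ])
  have ne: "P \<noteq> A" "Q \<noteq> A"
    using PQ by (auto simp: noncollinear_def)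
  consider "noncollinear A P B" "noncollinear A Q B"
    | "\<not> noncollinear A P B" "noncollinear A Q B"
    | "noncollinear A P B" "\<not> noncollinear A Q B"
    using noncollinear_cases[OF PQ, of B] three_lines(1) noncollinear_swap[of A B P]
      noncollinear_swap[of A B Q] by (auto simp: noncollinear_def[of A B C])
  then show ?thesis
  proof cases
    case 1
    then show ?thesis
      using side_ratio_cocycle[OF PQ 1(2,1)] ne by (simp add: radius_def)
  next
    case 2
    then show ?thesis
      by (rule radius_ratio_aux[OF PQ])
  next
    case 3
    have "radius Q = side_ratio A Q P * radius P"
      by (rule radius_ratio_aux[OF QP 3(2,1)])
    then have "side_ratio A P Q * radius Q = side_ratio A P Q * side_ratio A Q P * radius P"
      by simp
    then show ?thesis
      by (simp add: side_ratio_inverse[OF PQ])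
  qed
qed

definition glued :: "'a \<Rightarrow> 'a \<Rightarrow> real" where
  "glued P Q = (if P \<in> X \<and> Q \<in> X then
     sqrt ((radius P)\<^sup>2 + (radius Q)\<^sup>2 - 2 * radius P * radius Q * cos (ang P A Q)) else 0)"

lemma glued_nonneg: "0 \<le> glued P Q"
proof (cases "P \<in> X \<and> Q \<in> X")
  case True
  then have "2 * radius P * radius Q * cos (ang P A Q) \<le> 2 * radius P * radius Q * 1"
    by (intro mult_left_mono) (auto simp: radius_nonneg)
  then have "0 \<le> (radius P)\<^sup>2 + (radius Q)\<^sup>2 - 2 * radius P * radius Q * cos (ang P A Q)"
    using zero_le_power2[of "radius P - radius Q"] by (simp add: power2_diff)
  then show ?thesis
    by (simp add: glued_def)
qed (auto simp: glued_def)

lemma glued_commute: "glued P Q = glued Q P"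
proof (cases "P = A \<or> Q = A")
  case True
  then show ?thesis
    by (auto simp: glued_def radius_base)
next
  case False
  then show ?thesis
    using ang_sym[of P A Q] base_mem by (auto simp: glued_def ac_simps)
qed

lemma glued_eq_of_radius:
  assumes d: "euclidean_compatible S ang d" and S: "S \<subseteq> X" "A \<in> S"
    and rad: "\<And>T. T \<in> S \<Longrightarrow> d A T = radius T"
    and PQ: "P \<in> S" "Q \<in> S"
  shows "d P Q = glued P Q"
proof (cases "P = A \<or> Q = A")
  case True
  then have "d P Q = radius P + radius Q"
    using rad PQ compatible_commute[OF d, of _ A] radius_base by auto
  then show ?thesis
    using True PQ S radius_nonneg by (auto simp: glued_def radius_base subset_iff)
next
  case False
  have "(d P Q)\<^sup>2 = (radius P)\<^sup>2 + (radius Q)\<^sup>2 - 2 * radius P * radius Q * cos (ang P A Q)"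
    using compatible_cosine[OF d S(2) PQ] False rad PQ by auto
  then show ?thesis
    using PQ S compatible_nonneg[OF d]
    by (auto simp: glued_def subset_iff simp flip: \<open>(d P Q)\<^sup>2 = _\<close>)
qed

definition agrees_on :: "'a set \<Rightarrow> bool" where
  "agrees_on S \<longleftrightarrow>
     (\<exists>d. euclidean_compatible S ang d \<and> (\<forall>P\<in>S. \<forall>Q\<in>S. d P Q = glued P Q))"

lemma agrees_on_subset: "\<lbrakk>agrees_on S; T \<subseteq> S\<rbrakk> \<Longrightarrow> agrees_on T"
  unfolding agrees_on_def using euclidean_compatible_subset by (meson subset_iff)

text \<open>
  As in the uniqueness proof, a triangle \<open>APQ\<close> in the set forces the distances from \<open>A\<close> up to a
  common factor, and the radii satisfy the same constraints.
\<close>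

lemma agrees_on_triangle:
  assumes PQ: "noncollinear A P Q" and R: "R \<in> X"
  shows "agrees_on {A, P, Q, R}"
proof -
  have X: "A \<in> X" "P \<in> X" "Q \<in> X" "P \<noteq> A"
    using PQ by (auto simp: noncollinear_def)
  obtain d where d: "euclidean_compatible {A, P, Q, R} ang d"
    using four_points[OF X(1-3) R] by blast
  define c where "c = radius P / d A P"
  have dP: "0 < d A P"
    using compatible_pos[OF d] X by auto
  have c: "0 < c"
    using radius_pos[OF X(2,4)] dP by (simp add: c_def)
  have P: "c * d A P = radius P"
    using dP by (simp add: c_def)
  have step: "c * d A T = radius T"
    if "noncollinear A T U" "c * d A U = radius U" "T \<in> {A, P, Q, R}" "U \<in> {A, P, Q, R}" for T U
  proof -
    have "c * d A T = side_ratio A T U * (c * d A U)"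
      using compatible_side_ratio[OF d _ that(3,4,1)] by simp
    then show ?thesis
      using radius_ratio[OF that(1)] that(2) by simp
  qed
  have Q: "c * d A Q = radius Q"
    by (rule step[OF noncollinear_swap[OF PQ] P]) auto
  have "c * d A R = radius R"
  proof (cases "R = A")
    case True
    then show ?thesis
      using compatible_self[OF d, of A] radius_base by simp
  next
    case False
    then show ?thesis
      using noncollinear_cases[OF PQ R] step P Q by blast
  qed
  then have rad: "c * d A T = radius T" if "T \<in> {A, P, Q, R}" for T
    using that P Q compatible_self[OF d, of A] radius_base by auto
  show ?thesis
    unfolding agrees_on_def
  proof (intro exI conjI ballI)
    show comp: "euclidean_compatible {A, P, Q, R} ang (\<lambda>P Q. c * d P Q)"
      by (rule euclidean_compatible_scale[OF d c])
    fix U V assume "U \<in> {A, P, Q, R}" "V \<in> {A, P, Q, R}"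
    then show "c * d U V = glued U V"
      by (intro glued_eq_of_radius[OF comp]) (use X R rad in auto)
  qed
qed

lemma ex_off_line:
  assumes "P \<in> X" "P \<noteq> A"
  shows "\<exists>T. noncollinear A P T"
  using noncollinear_cases[OF three_lines(1) assms] by blast

lemma agrees_on_base_pair:
  assumes "Q \<in> X" "R \<in> X"
  shows "agrees_on {A, Q, R}"
proof -
  consider "Q \<noteq> A" | "R \<noteq> A" | "Q = A" "R = A" by blast
  then show ?thesis
  proof cases
    case 1
    then obtain T where "noncollinear A Q T"
      using ex_off_line assms by blast
    from agrees_on_triangle[OF this assms(2)] show ?thesis
      by (rule agrees_on_subset) auto
  next
    case 2
    then obtain T where "noncollinear A R T"
      using ex_off_line assms by blast
    from agrees_on_triangle[OF this assms(1)] show ?thesis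
      by (rule agrees_on_subset) auto
  next
    case 3
    show ?thesis
      using agrees_on_triangle[OF three_lines(1) base_mem] by (rule agrees_on_subset) (use 3 in auto)
  qed
qed

text \<open>
  Compatible metrics of a four-point set on one line need not be proportional to each other, so
  the metric of \<open>APQR\<close> cannot be compared with the radii here. A point \<open>T\<close> off the line helps: the angles
  force the metric of \<open>PQRT\<close> up to scale, and each of \<open>TPQ\<close>, \<open>TPR\<close>, \<open>TQR\<close> is in a four-point
  set with \<open>A\<close> on which the glued metric is known to be compatible.
\<close>

lemma agrees_on_line:
  assumes X: "P \<in> X" "Q \<in> X" "R \<in> X" and ne: "P \<noteq> A" "Q \<noteq> A" "R \<noteq> A"
    and col: "\<not> noncollinear A P Q" "\<not> noncollinear A P R" "\<not> noncollinear A Q R"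
  shows "agrees_on {P, Q, R}"
proof -
  obtain T where PT: "noncollinear A P T"
    using ex_off_line X ne by blast
  then have T: "T \<in> X" "T \<noteq> P"
    by (auto simp: noncollinear_def)
  have QT: "noncollinear A Q T" and RT: "noncollinear A R T"
    using noncollinear_cases[OF PT X(2) ne(2)] noncollinear_cases[OF PT X(3) ne(3)] col
      noncollinear_swap[of A Q P] noncollinear_swap[of A R P] by blast+
  obtain d where d: "euclidean_compatible {P, Q, R, T} ang d"
    using four_points[OF X T(1)] by blast
  define c where "c = glued T P / d T P"
  have dTP: "0 < d T P"
    using compatible_pos[OF d] T by auto
  \<comment> \<open>Positivity of the glued distance needs a metric that it agrees with.\<close>
  obtain e where e: "euclidean_compatible {A, P, T, P} ang e"
    "\<forall>U\<in>{A, P, T, P}. \<forall>V\<in>{A, P, T, P}. e U V = glued U V"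
    using agrees_on_triangle[OF PT X(1)] unfolding agrees_on_def by blast
  have "0 < glued T P"
    using compatible_pos[OF e(1), of T P] e(2) T by auto
  then have c: "0 < c"
    using dTP by (simp add: c_def)
  have P: "c * d T P = glued T P"
    using dTP by (simp add: c_def)
  have star: "c * d T U = glued T U"
    if U: "U \<in> {P, Q, R}" "\<not> noncollinear A P U" for U
  proof (cases "U = P")
    case True
    then show ?thesis
      using P by simp
  next
    case False
    have UX: "U \<in> X"
      using U X by blast
    have "noncollinear P A T"
      by (rule noncollinear_rotate[OF noncollinear_rotate[OF noncollinear_swap[OF PT]]])
    then have "noncollinear P U A \<or> noncollinear P U T"
      by (rule noncollinear_cases[OF _ UX False])
    then have tri: "noncollinear T U P"
      using U(2) noncollinear_rotate[of P U A] noncollinear_rotate[of U A P]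
        noncollinear_rotate[of P U T] noncollinear_rotate[of U T P] noncollinear_swap[of T P U]
      by blast
    obtain e where e: "euclidean_compatible {A, P, T, U} ang e"
      "\<forall>V\<in>{A, P, T, U}. \<forall>W\<in>{A, P, T, U}. e V W = glued V W"
      using agrees_on_triangle[OF PT UX] unfolding agrees_on_def by blast
    have "glued T U = side_ratio T U P * glued T P"
      using compatible_side_ratio[OF e(1) _ _ _ tri] e(2) by simp
    moreover have "d T U = side_ratio T U P * d T P"
      using compatible_side_ratio[OF d _ _ _ tri] U by auto
    ultimately show ?thesis
      by (simp flip: P)
  qed
  have PP: "\<not> noncollinear A P P"
    by (simp add: noncollinear_def)
  have rad: "c * d T U = glued T U" if "U \<in> {P, Q, R}" for U
    using that star PP col by blast
  have comp: "euclidean_compatible {P, Q, R, T} ang (\<lambda>P Q. c * d P Q)"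
    by (rule euclidean_compatible_scale[OF d c])
  have "c * d U V = glued U V" if UV: "U \<in> {P, Q, R}" "V \<in> {P, Q, R}" for U V
  proof -
    have UT: "noncollinear A U T"
      using UV(1) PT QT RT by blast
    have "V \<in> X"
      using UV X by blast
    then obtain e where e: "euclidean_compatible {A, U, T, V} ang e"
      "\<forall>W\<in>{A, U, T, V}. \<forall>Z\<in>{A, U, T, V}. e W Z = glued W Z"
      using agrees_on_triangle[OF UT] unfolding agrees_on_def by blast
    have "c * d U V = e U V"
      by (rule compatible_determined_from_point[OF comp e(1), of T])
        (use UV rad e(2) in auto)
    then show ?thesis
      using e(2) by simp
  qed
  then show ?thesis
    unfolding agrees_on_def
    using euclidean_compatible_subset[OF comp, of "{P, Q, R}"] by blast
qed

lemma agrees_on_triple: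
  assumes X: "P \<in> X" "Q \<in> X" "R \<in> X"
  shows "agrees_on {P, Q, R}"
proof -
  consider "P = A" | "Q = A" | "R = A"
    | "noncollinear A P Q" | "noncollinear A P R" | "noncollinear A Q R"
    | "P \<noteq> A" "Q \<noteq> A" "R \<noteq> A"
      "\<not> noncollinear A P Q" "\<not> noncollinear A P R" "\<not> noncollinear A Q R"
    by argo
  then show ?thesis
  proof cases
    case 1
    with agrees_on_base_pair[OF X(2,3)] show ?thesis by simp
  next
    case 2
    with agrees_on_base_pair[OF X(1,3)] show ?thesis by (simp add: insert_commute)
  next
    case 3
    with agrees_on_base_pair[OF X(1,2)] show ?thesis by (simp add: insert_commute)
  next
    case 4
    from agrees_on_triangle[OF 4 X(3)] show ?thesis by (rule agrees_on_subset) auto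
  next
    case 5
    from agrees_on_triangle[OF 5 X(2)] show ?thesis by (rule agrees_on_subset) auto
  next
    case 6
    from agrees_on_triangle[OF 6 X(1)] show ?thesis by (rule agrees_on_subset) auto
  next
    case 7
    then show ?thesis by (rule agrees_on_line[OF X])
  qed
qed

lemma glued_compatible: "euclidean_compatible X ang glued"
  by (rule euclidean_compatible_if_locally[OF glued_nonneg glued_commute])
    (rule agrees_on_triple[unfolded agrees_on_def])

end

section \<open>Four-point subspaces decide\<close>

lemma ex_superset_card_4:
  assumes "infinite X \<or> card X \<ge> 4" and PQRT: "{P, Q, R, T} \<subseteq> X"
  shows "\<exists>S. {P, Q, R, T} \<subseteq> S \<and> S \<subseteq> X \<and> card S = 4"
proof -
  have "\<exists>F\<subseteq>X. finite F \<and> card F = 4"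
  proof (cases "finite X")
    case True
    then show ?thesis
      using assms(1) obtain_subset_with_card_n[of 4 X] by metis
  next
    case False
    then show ?thesis
      using infinite_arbitrarily_large[of X 4] by blast
  qed
  then obtain F where F: "finite F" "F \<subseteq> X" "card F = 4"
    by blast
  have "4 \<le> card (F \<union> {P, Q, R, T})"
    using card_mono[OF _ Un_upper1, of F "{P, Q, R, T}"] F by simp
  moreover have "card {P, Q, R, T} \<le> 4"
    by (simp add: card_insert_if)
  ultimately obtain S where "{P, Q, R, T} \<subseteq> S" "S \<subseteq> F \<union> {P, Q, R, T}" "card S = 4"
    using exists_subset_between[of "{P, Q, R, T}" 4 "F \<union> {P, Q, R, T}"] F(1) by blast
  moreover have "F \<union> {P, Q, R, T} \<subseteq> X"
    by (rule Un_least[OF F(2) PQRT])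
  ultimately show ?thesis
    by (meson subset_trans)
qed

theorem theorem6:
  fixes X :: "'a set" and Bt :: "('a \<times> 'a \<times> 'a) set"
    and ang :: "'a \<Rightarrow> 'a \<Rightarrow> 'a \<Rightarrow> real"
  assumes "angle_space X Bt ang"
    and "\<not> trivial_space X Bt"
    and "infinite X \<or> card X \<ge> 4"
  shows "((\<exists>d. euclidean_compatible X ang d) \<longleftrightarrow>
            (\<forall>S. S \<subseteq> X \<and> card S = 4 \<longrightarrow> (\<exists>d. euclidean_compatible S ang d))) \<and>
         (\<forall>d d'. euclidean_compatible X ang d \<and> euclidean_compatible X ang d' \<longrightarrow>
            (\<exists>c>0. \<forall>A\<in>X. \<forall>B\<in>X. d' A B = c * d A B))"
proof -
  interpret angle_space X Bt ang
    by (rule assms(1))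
  obtain A B C where ABC: "noncollinear A B C"
    using assms(2) unfolding trivial_space_def noncollinear_def by blast
  have "\<not> X \<subseteq> {A, B, C}"
  proof
    assume sub: "X \<subseteq> {A, B, C}"
    then have "card X \<le> card {A, B, C}" and "finite X"
      by (auto intro: card_mono finite_subset)
    moreover have "card {A, B, C} \<le> 3"
      by (simp add: card_insert_if)
    ultimately show False
      using assms(3) by linarith
  qed
  then obtain D where D: "D \<in> X" "D \<notin> {A, B, C}"
    by blast
  have "\<exists>d. euclidean_compatible X ang d"
    if quad: "\<forall>S. S \<subseteq> X \<and> card S = 4 \<longrightarrow> (\<exists>d. euclidean_compatible S ang d)"
  proof -
    obtain P Q R T where
      lines: "noncollinear P Q R" "noncollinear P Q T" "noncollinear P R T"
      using ex_three_lines[OF ABC D] by blast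
    interpret four_point_compatible X Bt ang P Q R T
    proof
      fix P Q R T assume "P \<in> X" "Q \<in> X" "R \<in> X" "T \<in> X"
      then obtain S where "{P, Q, R, T} \<subseteq> S" "S \<subseteq> X" "card S = 4"
        using ex_superset_card_4[OF assms(3), of P Q R T] by auto
      then show "\<exists>d. euclidean_compatible {P, Q, R, T} ang d"
        using quad euclidean_compatible_subset by metis
    qed (rule lines)+
    show ?thesis
      using glued_compatible by blast
  qed
  moreover have "\<exists>d. euclidean_compatible S ang d"
    if "euclidean_compatible X ang d" "S \<subseteq> X" for d S
    using euclidean_compatible_subset[OF that] by blast
  ultimately show ?thesis
    using compatible_unique_up_to_scale[OF ABC] by blast
qed

end
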